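(* Let $G$ be a finite group of order $n$, let $A=(a_0,\dots,a_{n-1})$ and $B=(b_0,\dots,b_{n-1})$ be orderings of the elements of $G$, and let $P(G,A,B)$ be the corresponding automorphism-maximal profile in regular normal form. Then $$r_M(m,w)+r_W(w,m)=n+1\ \text{ for all pairs } (m,w)\quad\Longleftrightarrow\quad b_s=a_{n-1-s}^{-1}\ \text{ for all } s\in\{0,\dots,n-1\}.$$ That is, among all $(n!)^2$ regular normal forms $P(G,A,B)$ over a fixed group $G$ (one for each pair $(A,B)$ of orderings), exactly the $n!$ choices with $B=(a_{n-1}^{-1},a_{n-2}^{-1},\dots,a_0^{-1})$ satisfy the constant rank-sum identity; these are precisely the regular anti-phase templates $P(G,A)$.
   Context: A strict complete size-$n$ profile $S$ consists of $n$ men and $n$ women, each having a strict total order over all participants of the opposite side. $r_M(m,w)$ denotes the rank of woman $w$ in man $m$'s list and $r_W(w,m)$ the rank of man $m$ in woman $w$'s list (the top choice has rank $1$). An automorphism of $S$ is a pair $(\sigma,\tau)$ of a permutation $\sigma$ of the men and a permutation $\tau$ of the women with $r_M(m,w)=r_M(\sigma(m),\tau(w))$ and $r_W(w,m)=r_W(\tau(w),\sigma(m))$ for all $m,w$; $S$ is automorphism-maximal if $|\operatorname{Aut}(S)|=n$. An ordering of a finite group $G$ of order $n$ is a tuple of length $n$ listing each element of $G$ exactly once. Regular normal form: the profile $P(G,A,B)$ has men $m_g$ and women $w_g$ indexed by $g\in G$, with preference lists $$m_g:\ w_{ga_0}\succ w_{ga_1}\succ\cdots\succ w_{ga_{n-1}},\qquad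 w_h:\ m_{hb_0}\succ m_{hb_1}\succ\cdots\succ m_{hb_{n-1}}.$$ The regular anti-phase template $P(G,A)$ is $P(G,A,B)$ with $b_s=a_{n-1-s}^{-1}$ for all $s$. *)

theory Defs
  imports "HOL-Algebra.Coset" "HOL-Combinatorics.Permutations" "HOL-Combinatorics.Multiset_Permutations"
begin

text \<open>
  A preference list enumerates the participants of the opposite side, most preferred first; a
  strict total order on a finite set is the same thing as a duplicate-free enumeration of it.
  The preference functions are only meaningful on \<open>men\<close> and \<open>women\<close> respectively.
\<close>

record ('m, 'w) profile =
  men :: "'m set"
  women :: "'w set"
  prefs_M :: "'m \<Rightarrow> 'w list"
  prefs_W :: "'w \<Rightarrow> 'm list"

definition strict_complete_profile :: "nat \<Rightarrow> ('m, 'w) profile \<Rightarrow> bool" where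
  "strict_complete_profile n S \<longleftrightarrow>
     finite (men S) \<and> card (men S) = n \<and> finite (women S) \<and> card (women S) = n \<and>
     (\<forall>m\<in>men S. prefs_M S m \<in> permutations_of_set (women S)) \<and>
     (\<forall>w\<in>women S. prefs_W S w \<in> permutations_of_set (men S))"

text \<open>Ranks start at 1, list positions at 0.\<close>

definition rank_in :: "'a list \<Rightarrow> 'a \<Rightarrow> nat" where
  "rank_in xs x = (THE i. i < length xs \<and> xs ! i = x) + 1"

definition rank_M :: "('m, 'w) profile \<Rightarrow> 'm \<Rightarrow> 'w \<Rightarrow> nat" where
  "rank_M S m w = rank_in (prefs_M S m) w"

definition rank_W :: "('m, 'w) profile \<Rightarrow> 'w \<Rightarrow> 'm \<Rightarrow> nat" where
  "rank_W S w m = rank_in (prefs_W S w) m"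

text \<open>
  \<open>permutes\<close> makes a permutation the identity outside its set, so that each permutation of
  the men (women) is represented, and counted, exactly once.
\<close>

definition automorphisms :: "('m, 'w) profile \<Rightarrow> (('m \<Rightarrow> 'm) \<times> ('w \<Rightarrow> 'w)) set" where
  "automorphisms S = {(\<sigma>, \<tau>). \<sigma> permutes men S \<and> \<tau> permutes women S \<and>
     (\<forall>m\<in>men S. \<forall>w\<in>women S. rank_M S m w = rank_M S (\<sigma> m) (\<tau> w) \<and>
                              rank_W S w m = rank_W S (\<tau> w) (\<sigma> m))}"

definition automorphism_maximal :: "nat \<Rightarrow> ('m, 'w) profile \<Rightarrow> bool" where
  "automorphism_maximal n S \<longleftrightarrow> strict_complete_profile n S \<and> card (automorphisms S) = n"

definition constant_rank_sum :: "nat \<Rightarrow> ('m, 'w) profile \<Rightarrow> bool" where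
  "constant_rank_sum n S \<longleftrightarrow>
     (\<forall>m\<in>men S. \<forall>w\<in>women S. rank_M S m w + rank_W S w m = n + 1)"

definition group_orderings :: "('a, 'b) monoid_scheme \<Rightarrow> 'a list set" where
  "group_orderings G = permutations_of_set (carrier G)"

text \<open>
  Man \<open>m\<^sub>g\<close> and woman \<open>w\<^sub>g\<close> are both represented by their index \<open>g\<close>; the two sides are kept
  apart by the record fields.
\<close>

definition regular_profile ::
    "('a, 'b) monoid_scheme \<Rightarrow> 'a list \<Rightarrow> 'a list \<Rightarrow> ('a, 'a) profile" where
  "regular_profile G A B =
     \<lparr>men = carrier G, women = carrier G,
      prefs_M = (\<lambda>g\<in>carrier G. map (\<lambda>a. g \<otimes>\<^bsub>G\<^esub> a) A),
      prefs_W = (\<lambda>h\<in>carrier G. map (\<lambda>b. h \<otimes>\<^bsub>G\<^esub> b) B)\<rparr>"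

definition antiphase_ordering :: "('a, 'b) monoid_scheme \<Rightarrow> 'a list \<Rightarrow> 'a list" where
  "antiphase_ordering G A = map (\<lambda>s. inv\<^bsub>G\<^esub> (A ! (order G - 1 - s))) [0..<order G]"

definition antiphase_template ::
    "('a, 'b) monoid_scheme \<Rightarrow> 'a list \<Rightarrow> ('a, 'a) profile" where
  "antiphase_template G A = regular_profile G A (antiphase_ordering G A)"

definition regular_normal_forms :: "('a, 'b) monoid_scheme \<Rightarrow> ('a, 'a) profile set" where
  "regular_normal_forms G =
     {regular_profile G A B | A B. A \<in> group_orderings G \<and> B \<in> group_orderings G}"

end

theory Submission
  imports Defs
begin

text \<open>
  In a regular profile both ranks depend only on the quotient \<open>x = g\<inverse>h\<close>: the rank of \<open>w\<^sub>h\<close>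
  for \<open>m\<^sub>g\<close> is the rank of \<open>x\<close> in \<open>A\<close>, and the rank of \<open>m\<^sub>g\<close> for \<open>w\<^sub>h\<close> is the rank of
  \<open>x\<inverse>\<close> in \<open>B\<close>. The rank sum is therefore constant iff \<open>x \<mapsto> x\<inverse>\<close> carries \<open>A\<close> to the reversal
  of \<open>B\<close>. Likewise an automorphism has to preserve all quotients \<open>g\<inverse>h\<close>, so it is a left
  translation.
\<close>

section \<open>Ranks in duplicate-free lists\<close>

lemma rank_in_nth:
  assumes "distinct xs" "i < length xs"
  shows "rank_in xs (xs ! i) = i + 1"
proof -
  have "(THE j. j < length xs \<and> xs ! j = xs ! i) = i"
    using assms by (intro the_equality) (auto simp: nth_eq_iff_index_eq)
  then show ?thesis by (simp add: rank_in_def)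
qed

text \<open>Trades a condition on ranks for a lookup at a position; \<open>Suc\<close> absorbs the
  offset between ranks, which start at 1, and positions, which start at 0.\<close>

lemma rank_in_eq_Suc_iff:
  assumes "distinct xs" "x \<in> set xs" "i < length xs"
  shows "rank_in xs x = Suc i \<longleftrightarrow> xs ! i = x"
proof -
  obtain j where "j < length xs" "x = xs ! j"
    using assms(2) by (auto simp: in_set_conv_nth)
  with assms show ?thesis
    by (auto simp: rank_in_nth nth_eq_iff_index_eq)
qed

text \<open>Lets equal ranks in \<open>A\<close> be read as equal group quotients when automorphisms
  are determined.\<close>

lemma rank_in_inject:
  assumes "distinct xs" "x \<in> set xs" "y \<in> set xs"
  shows "rank_in xs x = rank_in xs y \<longleftrightarrow> x = y"
  using assms by (auto simp: in_set_conv_nth rank_in_nth)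

lemma rank_in_map:
  assumes "inj_on f (set xs)" "distinct xs" "x \<in> set xs"
  shows "rank_in (map f xs) (f x) = rank_in xs x"
proof -
  obtain j where j: "j < length xs" "x = xs ! j"
    using assms(3) by (auto simp: in_set_conv_nth)
  have "distinct (map f xs)"
    using assms by (simp add: distinct_map)
  from rank_in_nth[OF this, of j] j assms(2) show ?thesis
    by (simp add: rank_in_nth)
qed

lemma group_orderingsD:
  assumes "A \<in> group_orderings G"
  shows "set A = carrier G" "distinct A" "length A = order G"
  using assms by (auto simp: group_orderings_def permutations_of_set_def order_def
      dest: distinct_card)

section \<open>Ranks in regular profiles as functions of a quotient\<close>

context group
begin

lemma rank_in_map_mult:
  assumes "A \<in> group_orderings G" "g \<in> carrier G" "h \<in> carrier G"
  shows "rank_in (map (\<lambda>a. g \<otimes> a) A) h = rank_in A (inv g \<otimes> h)"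
proof -
  \<comment> \<open>Written as \<open>g \<otimes> (inv g \<otimes> h)\<close>, the element
    \<open>h\<close> is the image of \<open>inv g \<otimes> h\<close> under an injective relabelling
    of \<open>A\<close>, and relabelling keeps positions.\<close>
  have "rank_in (map (\<lambda>a. g \<otimes> a) A) (g \<otimes> (inv g \<otimes> h)) = rank_in A (inv g \<otimes> h)"
    using assms group_orderingsD[OF assms(1)] by (intro rank_in_map) (auto simp: inj_on_def)
  then show ?thesis using assms by (simp flip: m_assoc)
qed

lemma rank_M_regular_profile:
  assumes "A \<in> group_orderings G" "g \<in> carrier G" "h \<in> carrier G"
  shows "rank_M (regular_profile G A B) g h = rank_in A (inv g \<otimes> h)"
  using assms by (simp add: rank_M_def regular_profile_def rank_in_map_mult)

lemma rank_W_regular_profile: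
  assumes "B \<in> group_orderings G" "g \<in> carrier G" "h \<in> carrier G"
  shows "rank_W (regular_profile G A B) h g = rank_in B (inv h \<otimes> g)"
  using assms by (simp add: rank_W_def regular_profile_def rank_in_map_mult)

section \<open>The automorphism group and its size\<close>

lemma map_mult_group_orderings:
  assumes "A \<in> group_orderings G" "g \<in> carrier G"
  shows "map (\<lambda>a. g \<otimes> a) A \<in> group_orderings G"
proof -
  have "(\<lambda>a. g \<otimes> a) ` carrier G = carrier G"
    using assms(2) by (rule surj_const_mult)
  then show ?thesis
    using assms group_orderingsD[OF assms(1)]
    by (auto simp: group_orderings_def permutations_of_set_def distinct_map inj_on_def)
qed

text \<open>Extended by the identity outside the carrier, as \<open>permutes\<close> demands, so
  that the automorphisms can be listed as an exact set of functions.\<close>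

definition left_translation :: "'a \<Rightarrow> 'a \<Rightarrow> 'a" where
  "left_translation c x = (if x \<in> carrier G then c \<otimes> x else x)"

lemma left_translation_permutes:
  assumes "c \<in> carrier G"
  shows "left_translation c permutes carrier G"
proof (rule bij_imp_permutes)
  have "bij_betw (\<lambda>x. c \<otimes> x) (carrier G) (carrier G)"
    using assms by (simp add: bij_betw_def surj_const_mult inj_on_def)
  then show "bij_betw (left_translation c) (carrier G) (carrier G)"
    by (rule bij_betw_cong[THEN iffD1, rotated]) (simp add: left_translation_def)
qed (simp add: left_translation_def)

lemma automorphisms_regular_profile:
  assumes A: "A \<in> group_orderings G" and B: "B \<in> group_orderings G"
  shows "automorphisms (regular_profile G A B) =
    (\<lambda>c. (left_translation c, left_translation c)) ` carrier G" (is "?L = ?R")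
proof (intro equalityI subsetI)
  fix p assume "p \<in> ?L"
  then obtain \<sigma> \<tau> where p: "p = (\<sigma>, \<tau>)"
    and \<sigma>: "\<sigma> permutes carrier G" and \<tau>: "\<tau> permutes carrier G"
    and rank: "\<And>g h. g \<in> carrier G \<Longrightarrow> h \<in> carrier G \<Longrightarrow>
      rank_M (regular_profile G A B) g h = rank_M (regular_profile G A B) (\<sigma> g) (\<tau> h)"
    by (auto simp: automorphisms_def regular_profile_def)
  have closed: "\<sigma> x \<in> carrier G" "\<tau> x \<in> carrier G" if "x \<in> carrier G" for x
    using that \<sigma> \<tau> by (simp_all add: permutes_in_image)
  \<comment> \<open>Both ranks are ranks in the same duplicate-free list \<open>A\<close>, so their
    equality forces the elements ranked to coincide.\<close>
  have quot: "inv g \<otimes> h = inv (\<sigma> g) \<otimes> \<tau> h" if "g \<in> carrier G" "h \<in> carrier G" for g h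
    using rank[OF that] that A group_orderingsD[OF A] closed
    by (simp add: rank_M_regular_profile rank_in_inject)
  \<comment> \<open>A left translation is determined by its value at \<open>\<one>\<close>, so this
    is the only candidate.\<close>
  define c where "c = \<sigma> \<one>"
  have c: "c \<in> carrier G" by (simp add: c_def closed)
  have \<tau>_eq: "\<tau> h = c \<otimes> h" if "h \<in> carrier G" for h
  proof -
    \<comment> \<open>The case \<open>g = \<one>\<close> of \<open>quot\<close>.\<close>
    have "h = inv c \<otimes> \<tau> h"
      using quot[OF one_closed that] that by (simp add: c_def)
    then show ?thesis
      using c that closed by (metis inv_closed inv_solve_left inv_inv)
  qed
  have \<sigma>_eq: "\<sigma> g = c \<otimes> g" if "g \<in> carrier G" for g
  proof -
    \<comment> \<open>The case \<open>h = g\<close> of \<open>quot\<close>: a trivial quotient makes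
      \<sigma> and \<tau> agree at \<open>g\<close>.\<close>
    have "inv (\<sigma> g) \<otimes> \<tau> g = \<one>"
      using quot[OF that that] that by simp
    then have "\<sigma> g = \<tau> g"
      using that closed by (metis inv_closed inv_equality inv_inv)
    then show ?thesis using \<tau>_eq that by simp
  qed
  have "\<sigma> = left_translation c" "\<tau> = left_translation c"
    using \<sigma>_eq \<tau>_eq permutes_not_in[OF \<sigma>] permutes_not_in[OF \<tau>]
    by (auto simp: left_translation_def fun_eq_iff)
  with p c show "p \<in> ?R" by blast
next
  fix p assume "p \<in> ?R"
  then obtain c where c: "c \<in> carrier G" and p: "p = (left_translation c, left_translation c)"
    by blast
  \<comment> \<open>Translating both sides by the same \<open>c\<close> leaves every quotient
    unchanged, and both ranks depend on quotients alone.\<close>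
  have cancel: "inv (c \<otimes> g) \<otimes> (c \<otimes> h) = inv g \<otimes> h"
    if "g \<in> carrier G" "h \<in> carrier G" for g h
    using c that by (simp add: inv_mult_group m_assoc) (simp flip: m_assoc)
  have "rank_M (regular_profile G A B) g h =
      rank_M (regular_profile G A B) (left_translation c g) (left_translation c h)"
    "rank_W (regular_profile G A B) h g =
      rank_W (regular_profile G A B) (left_translation c h) (left_translation c g)"
    if "g \<in> carrier G" "h \<in> carrier G" for g h
    using that c A B
    by (simp_all add: left_translation_def rank_M_regular_profile rank_W_regular_profile cancel)
  with p left_translation_permutes[OF c] show "p \<in> ?L"
    by (simp add: automorphisms_def regular_profile_def)
qed

lemma automorphism_maximal_regular_profile:
  assumes fin: "finite (carrier G)" and A: "A \<in> group_orderings G" and B: "B \<in> group_orderings G"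
  shows "automorphism_maximal (order G) (regular_profile G A B)"
proof -
  have "strict_complete_profile (order G) (regular_profile G A B)"
    using fin map_mult_group_orderings[OF A] map_mult_group_orderings[OF B]
    by (simp add: strict_complete_profile_def regular_profile_def group_orderings_def order_def)
  moreover have "inj_on (\<lambda>c. (left_translation c, left_translation c)) (carrier G)"
  proof (rule inj_onI)
    fix c d assume "c \<in> carrier G" "d \<in> carrier G"
      and "(left_translation c, left_translation c) = (left_translation d, left_translation d)"
    \<comment> \<open>Evaluation at \<open>\<one>\<close> recovers the translating element, so
      distinct elements give distinct automorphisms and their number is
      \<open>order G\<close>.\<close>
    then have "left_translation c \<one> = left_translation d \<one>" by simp
    then show "c = d"
      using \<open>c \<in> carrier G\<close> \<open>d \<in> carrier G\<close> by (simp add: left_translation_def)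
  qed
  ultimately show ?thesis
    by (simp add: automorphism_maximal_def automorphisms_regular_profile[OF A B] card_image order_def)
qed

section \<open>The constant rank-sum identity\<close>

lemma constant_rank_sum_regular_profile_iff:
  assumes A: "A \<in> group_orderings G" and B: "B \<in> group_orderings G"
  shows "constant_rank_sum (order G) (regular_profile G A B) \<longleftrightarrow>
    (\<forall>s<order G. B ! s = inv (A ! (order G - 1 - s)))"
proof -
  let ?n = "order G"
  note AD = group_orderingsD[OF A] and BD = group_orderingsD[OF B]
  have "constant_rank_sum ?n (regular_profile G A B) \<longleftrightarrow>
      (\<forall>g\<in>carrier G. \<forall>h\<in>carrier G. rank_in A (inv g \<otimes> h) + rank_in B (inv h \<otimes> g) = ?n + 1)"
  proof -
    have "men (regular_profile G A B) = carrier G" "women (regular_profile G A B) = carrier G"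
      by (simp_all add: regular_profile_def)
    with A B show ?thesis
      by (simp add: constant_rank_sum_def rank_M_regular_profile rank_W_regular_profile)
  qed
  \<comment> \<open>Every \<open>x\<close> is the quotient of the pair \<open>\<one>\<close>,
    \<open>x\<close>; conversely \<open>inv h \<otimes> g\<close> is the inverse of
    \<open>inv g \<otimes> h\<close>.\<close>
  also have "\<dots> \<longleftrightarrow> (\<forall>x\<in>carrier G. rank_in A x + rank_in B (inv x) = ?n + 1)"
  proof (intro iffI ballI)
    fix x assume *: "\<forall>g\<in>carrier G. \<forall>h\<in>carrier G.
      rank_in A (inv g \<otimes> h) + rank_in B (inv h \<otimes> g) = ?n + 1" and x: "x \<in> carrier G"
    show "rank_in A x + rank_in B (inv x) = ?n + 1"
      using *[rule_format, OF one_closed x] x by simp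
  next
    fix g h assume *: "\<forall>x\<in>carrier G. rank_in A x + rank_in B (inv x) = ?n + 1"
      and gh: "g \<in> carrier G" "h \<in> carrier G"
    show "rank_in A (inv g \<otimes> h) + rank_in B (inv h \<otimes> g) = ?n + 1"
      using *[rule_format, of "inv g \<otimes> h"] gh by (simp add: inv_mult_group)
  qed
  \<comment> \<open>Since \<open>A\<close> enumerates the carrier, \<open>x\<close> may be replaced
    by \<open>A ! i\<close>.\<close>
  also have "\<dots> \<longleftrightarrow> (\<forall>i<?n. rank_in A (A ! i) + rank_in B (inv (A ! i)) = ?n + 1)"
    by (simp add: all_set_conv_all_nth AD(3) flip: AD(1))
  also have "\<dots> \<longleftrightarrow> (\<forall>i<?n. B ! (?n - 1 - i) = inv (A ! i))"
  proof (intro all_cong1 imp_cong refl)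
    fix i assume i: "i < ?n"
    have "inv (A ! i) \<in> set B"
      using i AD BD by (metis inv_closed nth_mem)
    \<comment> \<open>As \<open>A ! i\<close> has rank \<open>i + 1\<close>, its inverse must have
      rank \<open>?n - i\<close> in \<open>B\<close>, which is position \<open>?n - 1 - i\<close>
      counted from 0.\<close>
    then have "rank_in B (inv (A ! i)) = Suc (?n - 1 - i) \<longleftrightarrow> B ! (?n - 1 - i) = inv (A ! i)"
      using i BD by (intro rank_in_eq_Suc_iff) auto
    then show "rank_in A (A ! i) + rank_in B (inv (A ! i)) = ?n + 1 \<longleftrightarrow>
        B ! (?n - 1 - i) = inv (A ! i)"
      using i AD by (auto simp: rank_in_nth)
  qed
  \<comment> \<open>Reindexing by \<open>s = ?n - 1 - i\<close>, an involution on the positions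
    below \<open>?n\<close>.\<close>
  also have "\<dots> \<longleftrightarrow> (\<forall>s<?n. B ! s = inv (A ! (?n - 1 - s)))"
  proof (intro iffI allI impI)
    fix s assume *: "\<forall>i<?n. B ! (?n - 1 - i) = inv (A ! i)" and "s < ?n"
    then show "B ! s = inv (A ! (?n - 1 - s))"
      using *[rule_format, of "?n - 1 - s"] by simp
  next
    fix s assume *: "\<forall>s<?n. B ! s = inv (A ! (?n - 1 - s))" and "s < ?n"
    then show "B ! (?n - 1 - s) = inv (A ! s)"
      using *[rule_format, of "?n - 1 - s"] by simp
  qed
  finally show ?thesis .
qed

section \<open>Anti-phase orderings and distinctness of the normal forms\<close>

lemma antiphase_ordering_eq:
  assumes "A \<in> group_orderings G"
  shows "antiphase_ordering G A = rev (map (\<lambda>a. inv a) A)"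
  using group_orderingsD(3)[OF assms]
  by (intro nth_equalityI) (auto simp: antiphase_ordering_def rev_nth)

text \<open>Inversion is a bijection of the carrier and reversal only permutes positions. This
  ensures that every \<open>A\<close> admits a partner \<open>B\<close> and that every template is a
  regular normal form.\<close>

lemma antiphase_ordering_group_orderings:
  assumes "A \<in> group_orderings G"
  shows "antiphase_ordering G A \<in> group_orderings G"
proof -
  have "(\<lambda>a. inv a) ` carrier G = carrier G"
    by (metis inv_closed inv_inv image_eqI subsetI equalityI image_subsetI)
  then show ?thesis
    using group_orderingsD[OF assms] inv_inj
    by (simp add: antiphase_ordering_eq[OF assms] group_orderings_def permutations_of_set_def
        distinct_map)
qed

lemma constant_rank_sum_iff_antiphase_ordering:
  assumes A: "A \<in> group_orderings G" and B: "B \<in> group_orderings G"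
  shows "constant_rank_sum (order G) (regular_profile G A B) \<longleftrightarrow> B = antiphase_ordering G A"
  unfolding constant_rank_sum_regular_profile_iff[OF A B]
  using group_orderingsD(3)[OF B] by (auto simp: list_eq_iff_nth_eq antiphase_ordering_def)

text \<open>The lists of the man and the woman indexed by \<open>\<one>\<close> are \<open>A\<close>
  and \<open>B\<close> themselves, so the profile determines both orderings. Counting pairs thus
  counts profiles.\<close>

lemma inj_on_regular_profile:
  "inj_on (\<lambda>(A, B). regular_profile G A B) (group_orderings G \<times> group_orderings G)"
proof (rule inj_onI, clarify)
  fix A B A' B'
  assume in_go: "A \<in> group_orderings G" "B \<in> group_orderings G"
      "A' \<in> group_orderings G" "B' \<in> group_orderings G"
    and eq: "regular_profile G A B = regular_profile G A' B'"
  have one: "map (\<lambda>a. \<one> \<otimes> a) C = C" if "C \<in> group_orderings G" for C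
    using group_orderingsD(1)[OF that] by (intro map_idI) auto
  have "prefs_M (regular_profile G C D) \<one> = C" "prefs_W (regular_profile G C D) \<one> = D"
    if "C \<in> group_orderings G" "D \<in> group_orderings G" for C D
    using that one by (simp_all add: regular_profile_def)
  with in_go eq show "A = A' \<and> B = B'" by metis
qed

end

section \<open>Characterization and counts combined\<close>

theorem theorem4p7:
  fixes G :: "('a, 'b) monoid_scheme" and n :: nat
  assumes "group G" and "finite (carrier G)" and "order G = n"
  shows
    "(\<forall>A\<in>group_orderings G. \<forall>B\<in>group_orderings G.
        automorphism_maximal n (regular_profile G A B) \<and>
        (constant_rank_sum n (regular_profile G A B) \<longleftrightarrow>
          (\<forall>s\<in>{0..n - 1}. B ! s = inv\<^bsub>G\<^esub> (A ! (n - 1 - s))))) \<and>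
     inj_on (\<lambda>(A, B). regular_profile G A B) (group_orderings G \<times> group_orderings G) \<and>
     card (regular_normal_forms G) = (fact n)\<^sup>2 \<and>
     {(A, B) \<in> group_orderings G \<times> group_orderings G. constant_rank_sum n (regular_profile G A B)}
       = {(A, antiphase_ordering G A) | A. A \<in> group_orderings G} \<and>
     card {(A, B) \<in> group_orderings G \<times> group_orderings G.
             constant_rank_sum n (regular_profile G A B)} = fact n \<and>
     {S \<in> regular_normal_forms G. constant_rank_sum n S}
       = {antiphase_template G A | A. A \<in> group_orderings G}"
proof -
  interpret group G by fact
  let ?P = "\<lambda>(A, B). regular_profile G A B" and ?GO = "group_orderings G"
  have n: "n = order G" and n_pos: "n > 0"
    using assms order_gt_0_iff_finite by auto
  have card_GO: "card ?GO = fact n"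
    using assms by (simp add: group_orderings_def order_def)
  have nf: "regular_normal_forms G = ?P ` (?GO \<times> ?GO)"
    by (auto simp: regular_normal_forms_def)
  \<comment> \<open>Positivity of the order matters: with truncated subtraction, order 0 would give
    \<open>{0}\<close> on the left and the empty set on the right.\<close>
  have range: "{0..order G - 1} = {..<order G}"
    using n n_pos by auto
  have const_set: "{(A, B) \<in> ?GO \<times> ?GO. constant_rank_sum n (regular_profile G A B)}
      = {(A, antiphase_ordering G A) | A. A \<in> ?GO}"
    by (auto simp: n constant_rank_sum_iff_antiphase_ordering antiphase_ordering_group_orderings)
  show ?thesis
  proof (intro conjI ballI)
    fix A B assume A: "A \<in> ?GO" and B: "B \<in> ?GO"
    show "automorphism_maximal n (regular_profile G A B)"
      using automorphism_maximal_regular_profile[OF assms(2) A B] n by simp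
    show "constant_rank_sum n (regular_profile G A B) \<longleftrightarrow>
        (\<forall>s\<in>{0..n - 1}. B ! s = inv\<^bsub>G\<^esub> (A ! (n - 1 - s)))"
      unfolding n range constant_rank_sum_regular_profile_iff[OF A B] by auto
  next
    show "card (regular_normal_forms G) = (fact n)\<^sup>2"
      by (simp add: nf card_image[OF inj_on_regular_profile] card_cartesian_product card_GO
          power2_eq_square)
  next
    \<comment> \<open>The set is the graph of \<open>antiphase_ordering G\<close> on the orderings;
      the first component recovers \<open>A\<close>, so it has as many elements as there are
      orderings.\<close>
    have "{(A, antiphase_ordering G A) | A. A \<in> ?GO} = (\<lambda>A. (A, antiphase_ordering G A)) ` ?GO"
      by auto
    then show "card {(A, B) \<in> ?GO \<times> ?GO. constant_rank_sum n (regular_profile G A B)} = fact n"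
      by (simp only: const_set) (simp add: card_image inj_on_def card_GO)
  next
    show "{S \<in> regular_normal_forms G. constant_rank_sum n S} = {antiphase_template G A | A. A \<in> ?GO}"
      by (auto simp: regular_normal_forms_def antiphase_template_def n
          constant_rank_sum_iff_antiphase_ordering antiphase_ordering_group_orderings
          intro: antiphase_ordering_group_orderings)
  qed (fact inj_on_regular_profile const_set)+
qed

end
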